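(* Let $K$ be a field and $T=K[x]/(x^2)=K[\alpha]$, where $\alpha=x+(x^2)$. Then $R$ is a maximal subring of $T$ if and only if $R$ satisfies exactly one of the following conditions: (1) $R=S+K\alpha$ for some maximal subring $S$ of $K$. (2) $R=\{\sigma(a)+\delta(a)\alpha : a\in K\}$, where $\sigma\in \mathrm{Aut}(K)$ and $\delta$ is a $\sigma$-derivation of $K$.
   Context: All rings are commutative with $1\neq 0$ and subrings are unital. A proper subring $S$ of a ring $R$ is a maximal subring of $R$ if it is maximal with respect to inclusion among all proper subrings of $R$ (a subring of a field need not be a field). $\mathrm{Aut}(K)$ is the group of field automorphisms of $K$. For $\sigma\in\mathrm{Aut}(K)$, an additive map $\delta:K\to K$ is called a $\sigma$-derivation of $K$ if $\delta(ab)=\sigma(a)\delta(b)+\sigma(b)\delta(a)$ for all $a,b\in K$. *)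

theory Defs
  imports "HOL-Algebra.Algebra"
begin

definition maximal_subring :: "'a set \<Rightarrow> ('a, 'b) ring_scheme \<Rightarrow> bool" where
  "maximal_subring S R \<longleftrightarrow>
     subring S R \<and> S \<noteq> carrier R \<and>
     (\<forall>S'. subring S' R \<and> S' \<noteq> carrier R \<and> S \<subseteq> S' \<longrightarrow> S' = S)"

text \<open>The quotient of the polynomial ring over \<open>K\<close> by the principal ideal of \<open>x\<^sup>2\<close>.\<close>

definition dual_numbers :: "('a, 'b) ring_scheme \<Rightarrow> 'a list set ring" where
  "dual_numbers K = Rupt\<^bsub>K\<^esub> (carrier K) (X\<^bsub>K\<^esub> [^]\<^bsub>poly_ring K\<^esub> (2::nat))"

definition dual_class :: "('a, 'b) ring_scheme \<Rightarrow> 'a list \<Rightarrow> 'a list set" where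
  "dual_class K = ring.rupture_surj K (carrier K) (X\<^bsub>K\<^esub> [^]\<^bsub>poly_ring K\<^esub> (2::nat))"

definition dual_const :: "('a, 'b) ring_scheme \<Rightarrow> 'a \<Rightarrow> 'a list set" where
  "dual_const K a = dual_class K (ring.poly_of_const K a)"

definition dual_alpha :: "('a, 'b) ring_scheme \<Rightarrow> 'a list set" where
  "dual_alpha K = dual_class K X\<^bsub>K\<^esub>"

text \<open>Only the values of \<open>\<sigma>\<close> and \<open>\<delta>\<close> on \<open>carrier K\<close> are constrained. The automorphism group
  of \<open>K\<close> is \<open>ring_iso K K\<close>.\<close>

definition sigma_derivation :: "('a, 'b) ring_scheme \<Rightarrow> ('a \<Rightarrow> 'a) \<Rightarrow> ('a \<Rightarrow> 'a) \<Rightarrow> bool" where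
  "sigma_derivation K \<sigma> \<delta> \<longleftrightarrow>
     \<delta> \<in> hom (add_monoid K) (add_monoid K) \<and>
     (\<forall>a \<in> carrier K. \<forall>b \<in> carrier K.
        \<delta> (a \<otimes>\<^bsub>K\<^esub> b) = \<sigma> a \<otimes>\<^bsub>K\<^esub> \<delta> b \<oplus>\<^bsub>K\<^esub> \<sigma> b \<otimes>\<^bsub>K\<^esub> \<delta> a)"

definition is_preimage_subring :: "('a, 'b) ring_scheme \<Rightarrow> 'a list set set \<Rightarrow> bool" where
  "is_preimage_subring K R \<longleftrightarrow>
     (\<exists>S. maximal_subring S K \<and>
        R = {dual_const K s \<oplus>\<^bsub>dual_numbers K\<^esub> dual_const K k \<otimes>\<^bsub>dual_numbers K\<^esub> dual_alpha K | s k.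
               s \<in> S \<and> k \<in> carrier K})"

definition is_derivation_subring :: "('a, 'b) ring_scheme \<Rightarrow> 'a list set set \<Rightarrow> bool" where
  "is_derivation_subring K R \<longleftrightarrow>
     (\<exists>\<sigma> \<delta>. \<sigma> \<in> ring_iso K K \<and> sigma_derivation K \<sigma> \<delta> \<and>
        R = {dual_const K (\<sigma> a) \<oplus>\<^bsub>dual_numbers K\<^esub> dual_const K (\<delta> a) \<otimes>\<^bsub>dual_numbers K\<^esub> dual_alpha K | a.
               a \<in> carrier K})"

end

theory Submission
  imports Defs
begin

text \<open>Write \<open>T = K + K\<alpha>\<close> with \<open>\<alpha>\<^sup>2 = 0\<close>, and let \<open>R\<close> be a subring of \<open>T\<close>. The ideal \<open>K\<alpha>\<close> is the
  kernel of the ring homomorphism \<open>a + b\<alpha> \<mapsto> a\<close> from \<open>T\<close> onto \<open>K\<close>, and everything depends on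
  whether \<open>R\<close> contains it.

  If \<open>K\<alpha> \<subseteq> R\<close>, then \<open>R = S + K\<alpha>\<close>, where \<open>S\<close> is the image of \<open>R\<close> in \<open>K\<close>. This is the correspondence
  between the subrings of \<open>K\<close> and the subrings of \<open>T\<close> that contain the kernel, so it preserves
  maximality in both directions (\<open>maximal_thicken\<close>, \<open>maximal_proj\<close>).

  If \<open>K\<alpha>\<close> is not contained in \<open>R\<close> and \<open>R\<close> is maximal, then the strictly larger subring \<open>R + K\<alpha>\<close>
  is \<open>T\<close>, so \<open>R\<close> maps onto \<open>K\<close> (\<open>maximal_proj_full\<close>). Then \<open>R \<inter> K\<alpha>\<close> is a \<open>K\<close>-subspace of the line
  \<open>K\<alpha>\<close>, because \<open>(a + d\<alpha>)(b\<alpha>) = ab\<alpha>\<close>; as it is not the whole line it is \<open>0\<close>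
  (\<open>contains_all_multiples\<close>). Hence \<open>R\<close> maps bijectively to \<open>K\<close>; it is the graph of a map \<open>\<delta>\<close>, and
  closure under sums and products says that \<open>\<delta>\<close> is a derivation (\<open>section_is_derivation\<close>). The
  automorphism can thus always be taken to be the identity: a general one only reparametrises
  the same set.

  Conversely, \<open>{\<tau> a + \<delta> a \<alpha>}\<close> is a subring that maps bijectively to \<open>K\<close>
  (\<open>derivation_graph_section\<close>). A strictly larger subring contains two elements with the same image
  in \<open>K\<close>, hence a nonzero \<open>b\<alpha>\<close>, hence \<open>K\<alpha>\<close>, hence everything (\<open>maximal_if_section\<close>). The two kinds
  of subring are told apart by \<open>\<alpha>\<close>, which lies in those of the first kind only.

  The argument uses of the quotient \<open>K[x]/(x\<^sup>2)\<close> only that \<open>1\<close> and \<open>\<alpha>\<close> form a \<open>K\<close>-basis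
  and that \<open>\<alpha>\<^sup>2 = 0\<close>; division with remainder by \<open>x\<^sup>2\<close> supplies this
  (\<open>dual_numbers_algebra\<close>).\<close>

section \<open>Rings of dual numbers over a field\<close>

text \<open>\<open>T\<close> is described by its basis instead of as a quotient, so that elements are pairs of coefficients
  and no computation with cosets or polynomials enters the study of subrings.\<close>

locale dual_number_algebra = field K + T: cring T for K (structure) and T +
  fixes c :: "'a \<Rightarrow> 'c" and \<alpha> :: 'c
  assumes c_hom: "c \<in> ring_hom K T"
    and alpha_closed: "\<alpha> \<in> carrier T"
    and alpha_square: "\<alpha> \<otimes>\<^bsub>T\<^esub> \<alpha> = \<zero>\<^bsub>T\<^esub>"
    and spanning: "t \<in> carrier T \<Longrightarrow>
      \<exists>a \<in> carrier K. \<exists>b \<in> carrier K. t = c a \<oplus>\<^bsub>T\<^esub> c b \<otimes>\<^bsub>T\<^esub> \<alpha>"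
    and independent: "\<lbrakk>a \<in> carrier K; b \<in> carrier K; a' \<in> carrier K; b' \<in> carrier K;
        c a \<oplus>\<^bsub>T\<^esub> c b \<otimes>\<^bsub>T\<^esub> \<alpha> = c a' \<oplus>\<^bsub>T\<^esub> c b' \<otimes>\<^bsub>T\<^esub> \<alpha>\<rbrakk> \<Longrightarrow> a = a' \<and> b = b'"
begin

definition elt :: "'a \<Rightarrow> 'a \<Rightarrow> 'c" where
  "elt a b = c a \<oplus>\<^bsub>T\<^esub> c b \<otimes>\<^bsub>T\<^esub> \<alpha>"

text \<open>The preimage of \<open>A\<close> under \<open>elt a b \<mapsto> a\<close>, that is \<open>A + K\<alpha>\<close>.\<close>

definition thicken :: "'a set \<Rightarrow> 'c set" where
  "thicken A = {elt s k | s k. s \<in> A \<and> k \<in> carrier K}"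

text \<open>The image of \<open>R\<close> under \<open>elt a b \<mapsto> a\<close>.\<close>

definition proj :: "'c set \<Rightarrow> 'a set" where
  "proj R = {a \<in> carrier K. \<exists>b \<in> carrier K. elt a b \<in> R}"

lemma c_closed [simp, intro]: "a \<in> carrier K \<Longrightarrow> c a \<in> carrier T"
  using c_hom by (rule ring_hom_closed)

lemma elt_closed [simp, intro]: "\<lbrakk>a \<in> carrier K; b \<in> carrier K\<rbrakk> \<Longrightarrow> elt a b \<in> carrier T"
  unfolding elt_def using alpha_closed by simp

lemma elt_eq_iff:
  assumes "a \<in> carrier K" "b \<in> carrier K" "a' \<in> carrier K" "b' \<in> carrier K"
  shows "elt a b = elt a' b' \<longleftrightarrow> a = a' \<and> b = b'"
  using independent[OF assms] unfolding elt_def by auto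

lemma elt_cases:
  assumes "t \<in> carrier T"
  obtains a b where "a \<in> carrier K" "b \<in> carrier K" "t = elt a b"
  using spanning[OF assms] unfolding elt_def by blast

lemma elt_add:
  assumes "a \<in> carrier K" "b \<in> carrier K" "a' \<in> carrier K" "b' \<in> carrier K"
  shows "elt a b \<oplus>\<^bsub>T\<^esub> elt a' b' = elt (a \<oplus> a') (b \<oplus> b')"
proof -
  have cl: "c a \<in> carrier T" "c b \<in> carrier T" "c a' \<in> carrier T" "c b' \<in> carrier T"
    using assms by auto
  show ?thesis
    unfolding elt_def ring_hom_add[OF c_hom assms(1,3)] ring_hom_add[OF c_hom assms(2,4)]
    using cl alpha_closed by algebra
qed

lemma elt_mult:
  assumes "a \<in> carrier K" "b \<in> carrier K" "a' \<in> carrier K" "b' \<in> carrier K"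
  shows "elt a b \<otimes>\<^bsub>T\<^esub> elt a' b' = elt (a \<otimes> a') (a \<otimes> b' \<oplus> a' \<otimes> b)"
proof -
  have cl: "c a \<in> carrier T" "c b \<in> carrier T" "c a' \<in> carrier T" "c b' \<in> carrier T"
    using assms by auto
  have "elt a b \<otimes>\<^bsub>T\<^esub> elt a' b' =
      c a \<otimes>\<^bsub>T\<^esub> c a' \<oplus>\<^bsub>T\<^esub> (c a \<otimes>\<^bsub>T\<^esub> c b' \<oplus>\<^bsub>T\<^esub> c a' \<otimes>\<^bsub>T\<^esub> c b) \<otimes>\<^bsub>T\<^esub> \<alpha>
        \<oplus>\<^bsub>T\<^esub> (c b \<otimes>\<^bsub>T\<^esub> c b') \<otimes>\<^bsub>T\<^esub> (\<alpha> \<otimes>\<^bsub>T\<^esub> \<alpha>)"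
    unfolding elt_def using cl alpha_closed by algebra
  also have "\<dots> = c a \<otimes>\<^bsub>T\<^esub> c a' \<oplus>\<^bsub>T\<^esub> (c a \<otimes>\<^bsub>T\<^esub> c b' \<oplus>\<^bsub>T\<^esub> c a' \<otimes>\<^bsub>T\<^esub> c b) \<otimes>\<^bsub>T\<^esub> \<alpha>"
    unfolding alpha_square using cl alpha_closed by algebra
  also have "\<dots> = elt (a \<otimes> a') (a \<otimes> b' \<oplus> a' \<otimes> b)"
    unfolding elt_def using assms ring_hom_mult[OF c_hom] ring_hom_add[OF c_hom] by simp
  finally show ?thesis .
qed

lemma elt_one: "elt \<one> \<zero> = \<one>\<^bsub>T\<^esub>"
  unfolding elt_def
  using ring_hom_one[OF c_hom] ring_hom_zero[OF c_hom ring_axioms T.ring_axioms] alpha_closed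
  by simp

lemma elt_zero: "elt \<zero> \<zero> = \<zero>\<^bsub>T\<^esub>"
  unfolding elt_def
  using ring_hom_zero[OF c_hom ring_axioms T.ring_axioms] alpha_closed by simp

lemma elt_neg:
  assumes "a \<in> carrier K" "b \<in> carrier K"
  shows "\<ominus>\<^bsub>T\<^esub> elt a b = elt (\<ominus> a) (\<ominus> b)"
proof (rule T.minus_equality)
  show "elt (\<ominus> a) (\<ominus> b) \<oplus>\<^bsub>T\<^esub> elt a b = \<zero>\<^bsub>T\<^esub>"
    using assms by (simp add: elt_add elt_zero l_neg)
qed (use assms in auto)

section \<open>The correspondence between subrings of the field and of the dual numbers\<close>

lemma thicken_subring:
  assumes "subring A K"
  shows "subring (thicken A) T"
proof -
  note A = subringE[OF assms]
  have el: "elt s k \<in> thicken A" if "s \<in> A" "k \<in> carrier K" for s k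
    using that unfolding thicken_def by blast
  show ?thesis
  proof (rule T.subringI)
    show "thicken A \<subseteq> carrier T"
      unfolding thicken_def using A(1) by auto
    show "\<one>\<^bsub>T\<^esub> \<in> thicken A"
      using el[OF A(3) zero_closed] elt_one by simp
  next
    fix h assume "h \<in> thicken A"
    then obtain s k where "h = elt s k" "s \<in> A" "k \<in> carrier K"
      unfolding thicken_def by blast
    with A(1,5) el show "\<ominus>\<^bsub>T\<^esub> h \<in> thicken A"
      by (auto simp: elt_neg)
  next
    fix h h' assume "h \<in> thicken A" "h' \<in> thicken A"
    then obtain s k s' k' where h: "h = elt s k" "s \<in> A" "k \<in> carrier K"
        "h' = elt s' k'" "s' \<in> A" "k' \<in> carrier K"
      unfolding thicken_def by blast
    moreover have "s \<in> carrier K" "s' \<in> carrier K"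
      using h A(1) by auto
    ultimately show "h \<otimes>\<^bsub>T\<^esub> h' \<in> thicken A" "h \<oplus>\<^bsub>T\<^esub> h' \<in> thicken A"
      using A(6,7) by (auto simp: elt_mult elt_add intro!: el)
  qed
qed

lemma proj_subring:
  assumes "subring R T"
  shows "subring (proj R) K"
proof -
  note R = subringE[OF assms]
  show ?thesis
  proof (rule subringI)
    show "proj R \<subseteq> carrier K"
      unfolding proj_def by blast
    show "\<one> \<in> proj R"
      unfolding proj_def using R(3) elt_one by (auto intro!: bexI[of _ \<zero>])
  next
    fix h assume "h \<in> proj R"
    then show "\<ominus> h \<in> proj R"
      unfolding proj_def using R(5) by (force simp: elt_neg)
  next
    fix h h' assume "h \<in> proj R" "h' \<in> proj R"
    then obtain k k' where h: "h \<in> carrier K" "k \<in> carrier K" "elt h k \<in> R"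
        "h' \<in> carrier K" "k' \<in> carrier K" "elt h' k' \<in> R"
      unfolding proj_def by blast
    show "h \<otimes> h' \<in> proj R"
      unfolding proj_def using R(6)[OF h(3,6)] h by (auto simp: elt_mult)
    show "h \<oplus> h' \<in> proj R"
      unfolding proj_def using R(7)[OF h(3,6)] h by (auto simp: elt_add)
  qed
qed

lemma proj_thicken:
  assumes "A \<subseteq> carrier K"
  shows "proj (thicken A) = A"
proof
  show "proj (thicken A) \<subseteq> A"
  proof
    fix a assume "a \<in> proj (thicken A)"
    then obtain b s k where "a \<in> carrier K" "b \<in> carrier K" "s \<in> A" "k \<in> carrier K"
        "elt a b = elt s k"
      unfolding proj_def thicken_def by blast
    then show "a \<in> A"
      using assms elt_eq_iff by blast
  qed
  show "A \<subseteq> proj (thicken A)"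
    unfolding proj_def thicken_def using assms by blast
qed

lemma thicken_carrier: "thicken (carrier K) = carrier T"
  unfolding thicken_def by (auto elim: elt_cases)

lemma subset_thicken_proj:
  assumes "R \<subseteq> carrier T"
  shows "R \<subseteq> thicken (proj R)"
proof
  fix t assume "t \<in> R"
  then obtain a b where "a \<in> carrier K" "b \<in> carrier K" "t = elt a b"
    using assms elt_cases by blast
  with \<open>t \<in> R\<close> show "t \<in> thicken (proj R)"
    unfolding thicken_def proj_def by blast
qed

text \<open>An element with the right image in \<open>K\<close> differs from an element of \<open>R\<close> by a multiple of \<open>\<alpha>\<close>, and
  these multiples lie in \<open>R\<close>.\<close>

lemma thicken_proj:
  assumes "subring R T" and "\<And>k. k \<in> carrier K \<Longrightarrow> elt \<zero> k \<in> R"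
  shows "thicken (proj R) = R"
proof
  note R = subringE[OF assms(1)]
  show "thicken (proj R) \<subseteq> R"
  proof
    fix t assume "t \<in> thicken (proj R)"
    then obtain a k b where t: "t = elt a k" "a \<in> carrier K" "k \<in> carrier K" "b \<in> carrier K"
        "elt a b \<in> R"
      unfolding thicken_def proj_def by blast
    have "elt a b \<oplus>\<^bsub>T\<^esub> elt \<zero> (k \<ominus> b) \<in> R"
      using R(7) assms(2) t by simp
    moreover have "b \<oplus> (k \<ominus> b) = k"
      using t by algebra
    ultimately show "t \<in> R"
      using t by (simp add: elt_add)
  qed
  show "R \<subseteq> thicken (proj R)"
    by (rule subset_thicken_proj[OF R(1)])
qed

text \<open>Multiplication of \<open>b\<alpha>\<close> by an element of \<open>R\<close> depends only on the image of that element in \<open>K\<close>.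
  Since every scalar is such an image, \<open>R \<inter> K\<alpha>\<close> is closed under scalars from \<open>K\<close>; the scalar
  \<open>k/b\<close> takes \<open>b\<alpha>\<close> to \<open>k\<alpha>\<close>.\<close>

lemma contains_all_multiples:
  assumes "subring R T" and "proj R = carrier K"
    and "b \<in> carrier K" "b \<noteq> \<zero>" "elt \<zero> b \<in> R" and "k \<in> carrier K"
  shows "elt \<zero> k \<in> R"
proof -
  have "k \<otimes> inv b \<in> proj R"
    using assms field_Units by auto
  then obtain d where d: "d \<in> carrier K" "elt (k \<otimes> inv b) d \<in> R"
    unfolding proj_def by blast
  have u: "b \<in> Units K"
    using assms field_Units by auto
  have "elt (k \<otimes> inv b) d \<otimes>\<^bsub>T\<^esub> elt \<zero> b \<in> R"
    using subringE(6)[OF assms(1) d(2) assms(5)] .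
  moreover have "elt (k \<otimes> inv b) d \<otimes>\<^bsub>T\<^esub> elt \<zero> b = elt \<zero> k"
    using u d assms by (simp add: elt_mult m_assoc)
  ultimately show ?thesis
    by simp
qed

lemma maximal_thicken:
  assumes "maximal_subring S K"
  shows "maximal_subring (thicken S) T"
proof -
  have S: "subring S K" "S \<noteq> carrier K"
    and max: "\<And>S'. \<lbrakk>subring S' K; S' \<noteq> carrier K; S \<subseteq> S'\<rbrakk> \<Longrightarrow> S' = S"
    using assms unfolding maximal_subring_def by auto
  note SK = subringE(1)[OF S(1)]
  have "proj (carrier T) = carrier K"
    using proj_thicken[of "carrier K"] thicken_carrier by simp
  then have "thicken S \<noteq> carrier T"
    using proj_thicken[OF SK] S(2) by auto
  moreover have "R = thicken S" if R: "subring R T" "R \<noteq> carrier T" "thicken S \<subseteq> R" for R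
  proof -
    have "elt \<zero> k \<in> R" if "k \<in> carrier K" for k
      using R(3) subringE(2)[OF S(1)] that unfolding thicken_def by blast
    then have eq: "thicken (proj R) = R"
      by (rule thicken_proj[OF R(1)])
    have "proj (thicken S) \<subseteq> proj R"
      using R(3) unfolding proj_def by blast
    then have "S \<subseteq> proj R"
      using proj_thicken[OF SK] by simp
    moreover have "proj R \<noteq> carrier K"
      using eq R(2) thicken_carrier by auto
    ultimately have "proj R = S"
      using max proj_subring[OF R(1)] by blast
    then show ?thesis
      using eq by simp
  qed
  ultimately show ?thesis
    using thicken_subring[OF S(1)] unfolding maximal_subring_def by blast
qed

lemma maximal_proj:
  assumes "maximal_subring R T" and "\<And>k. k \<in> carrier K \<Longrightarrow> elt \<zero> k \<in> R"
  shows "maximal_subring (proj R) K"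
proof -
  have R: "subring R T" "R \<noteq> carrier T"
    and max: "\<And>R'. \<lbrakk>subring R' T; R' \<noteq> carrier T; R \<subseteq> R'\<rbrakk> \<Longrightarrow> R' = R"
    using assms(1) unfolding maximal_subring_def by auto
  have eq: "thicken (proj R) = R"
    using thicken_proj[OF R(1) assms(2)] .
  have "proj R \<noteq> carrier K"
    using eq R(2) thicken_carrier by auto
  moreover have "S = proj R" if S: "subring S K" "S \<noteq> carrier K" "proj R \<subseteq> S" for S
  proof -
    have pS: "proj (thicken S) = S"
      using proj_thicken[OF subringE(1)[OF S(1)]] .
    have "thicken S \<noteq> carrier T"
      using pS S(2) proj_thicken[of "carrier K"] thicken_carrier by auto
    moreover have "thicken (proj R) \<subseteq> thicken S"
      using S(3) unfolding thicken_def by blast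
    ultimately have "thicken S = R"
      using max thicken_subring[OF S(1)] eq by simp
    then show ?thesis
      using pS by simp
  qed
  ultimately show ?thesis
    using proj_subring[OF R(1)] unfolding maximal_subring_def by blast
qed

section \<open>Subrings that do not contain the kernel\<close>

text \<open>\<open>R + K\<alpha>\<close> is a subring containing \<open>R\<close> strictly, so by maximality it is the whole ring; and it has
  the same image in \<open>K\<close> as \<open>R\<close>.\<close>

lemma maximal_proj_full:
  assumes "maximal_subring R T" and "k \<in> carrier K" "elt \<zero> k \<notin> R"
  shows "proj R = carrier K"
proof -
  have R: "subring R T"
    and max: "\<And>R'. \<lbrakk>subring R' T; R' \<noteq> carrier T; R \<subseteq> R'\<rbrakk> \<Longrightarrow> R' = R"
    using assms(1) unfolding maximal_subring_def by auto
  have "elt \<zero> k \<in> thicken (proj R)"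
    using subringE(2)[OF proj_subring[OF R]] assms(2) unfolding thicken_def by blast
  then have "thicken (proj R) = carrier T"
    using max[OF thicken_subring[OF proj_subring[OF R]]]
      subset_thicken_proj[OF subringE(1)[OF R]] assms(3) by blast
  then show ?thesis
    using proj_thicken[OF subringE(1)[OF proj_subring[OF R]]] proj_thicken[of "carrier K"]
      thicken_carrier by auto
qed

text \<open>The hypotheses say that \<open>R\<close> maps bijectively to \<open>K\<close>. Then \<open>\<delta> a\<close> is the coefficient of \<open>\<alpha>\<close> in the
  element of \<open>R\<close> over \<open>a\<close>; comparing the elements over a sum and over a product with the sum and
  the product of the elements gives additivity and the Leibniz rule.\<close>

lemma section_is_derivation:
  assumes "subring R T" and "proj R = carrier K"
    and trivial: "\<And>k. \<lbrakk>k \<in> carrier K; elt \<zero> k \<in> R\<rbrakk> \<Longrightarrow> k = \<zero>"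
  shows "\<exists>\<delta>. sigma_derivation K id \<delta> \<and> R = {elt a (\<delta> a) | a. a \<in> carrier K}"
proof -
  note R = subringE[OF assms(1)]
  have unique: "b = b'" if "a \<in> carrier K" "b \<in> carrier K" "b' \<in> carrier K"
      "elt a b \<in> R" "elt a b' \<in> R" for a b b'
  proof -
    have "elt a b \<oplus>\<^bsub>T\<^esub> (\<ominus>\<^bsub>T\<^esub> elt a b') \<in> R"
      using R(5,7) that by blast
    moreover have "elt a b \<oplus>\<^bsub>T\<^esub> (\<ominus>\<^bsub>T\<^esub> elt a b') = elt \<zero> (b \<ominus> b')"
      using that by (simp add: elt_neg elt_add r_neg minus_eq)
    ultimately have "b \<ominus> b' = \<zero>"
      using trivial that by simp
    then show ?thesis
      using that r_right_minus_eq by blast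
  qed
  have "\<forall>a \<in> carrier K. \<exists>b. b \<in> carrier K \<and> elt a b \<in> R"
    using assms(2) unfolding proj_def by blast
  then obtain \<delta> where \<delta>: "\<And>a. a \<in> carrier K \<Longrightarrow> \<delta> a \<in> carrier K \<and> elt a (\<delta> a) \<in> R"
    by metis
  have graph: "b = \<delta> a" if "a \<in> carrier K" "b \<in> carrier K" "elt a b \<in> R" for a b
    using unique \<delta> that by blast
  have "\<delta> (a \<oplus> b) = \<delta> a \<oplus> \<delta> b" if "a \<in> carrier K" "b \<in> carrier K" for a b
    using graph[of "a \<oplus> b" "\<delta> a \<oplus> \<delta> b"] R(7) \<delta> that elt_add by (metis add.m_closed)
  moreover have "\<delta> (a \<otimes> b) = a \<otimes> \<delta> b \<oplus> b \<otimes> \<delta> a" if "a \<in> carrier K" "b \<in> carrier K" for a b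
    using graph[of "a \<otimes> b" "a \<otimes> \<delta> b \<oplus> b \<otimes> \<delta> a"] R(6) \<delta> that elt_mult
    by (metis add.m_closed m_closed)
  ultimately have "sigma_derivation K id \<delta>"
    unfolding sigma_derivation_def hom_def using \<delta> by auto
  moreover have "R = {elt a (\<delta> a) | a. a \<in> carrier K}"
  proof
    show "R \<subseteq> {elt a (\<delta> a) | a. a \<in> carrier K}"
    proof
      fix t assume t: "t \<in> R"
      then obtain a b where "a \<in> carrier K" "b \<in> carrier K" "t = elt a b"
        using R(1) elt_cases by blast
      with t graph show "t \<in> {elt a (\<delta> a) | a. a \<in> carrier K}"
        by blast
    qed
  qed (use \<delta> in blast)
  ultimately show ?thesis
    by blast
qed

text \<open>An element outside \<open>R\<close> and the element of \<open>R\<close> with the same image differ by a nonzero multiple of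
  \<open>\<alpha>\<close>. A subring that contains both therefore contains \<open>K\<alpha>\<close>, and since it maps onto \<open>K\<close> it
  is the whole ring.\<close>

lemma maximal_if_section:
  assumes R: "subring R T" and full: "proj R = carrier K"
    and trivial: "\<And>k. \<lbrakk>k \<in> carrier K; elt \<zero> k \<in> R\<rbrakk> \<Longrightarrow> k = \<zero>"
  shows "maximal_subring R T"
proof -
  have "elt \<zero> \<one> \<notin> R"
    using trivial[OF one_closed] one_not_zero by blast
  then have "R \<noteq> carrier T"
    by auto
  moreover have "R' = R" if R': "subring R' T" "R' \<noteq> carrier T" "R \<subseteq> R'" for R'
  proof (rule ccontr)
    assume "R' \<noteq> R"
    then obtain t where t: "t \<in> R'" "t \<notin> R"
      using R'(3) by blast
    then obtain a b where ab: "a \<in> carrier K" "b \<in> carrier K" "t = elt a b"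
      using subringE(1)[OF R'(1)] elt_cases by blast
    have "a \<in> proj R"
      using full ab by simp
    then obtain d where d: "d \<in> carrier K" "elt a d \<in> R"
      unfolding proj_def by blast
    have "elt a b \<oplus>\<^bsub>T\<^esub> (\<ominus>\<^bsub>T\<^esub> elt a d) \<in> R'"
      using subringE(5,7)[OF R'(1)] t ab d R'(3) by blast
    moreover have "elt a b \<oplus>\<^bsub>T\<^esub> (\<ominus>\<^bsub>T\<^esub> elt a d) = elt \<zero> (b \<ominus> d)"
      using ab d by (simp add: elt_neg elt_add r_neg minus_eq)
    ultimately have mem: "elt \<zero> (b \<ominus> d) \<in> R'"
      by simp
    have "b \<noteq> d"
      using t ab d by auto
    then have nz: "b \<ominus> d \<noteq> \<zero>"
      using ab d r_right_minus_eq by blast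
    have full': "proj R' = carrier K"
      using full R'(3) unfolding proj_def by blast
    have "elt \<zero> k \<in> R'" if "k \<in> carrier K" for k
      using contains_all_multiples[OF R'(1) full' _ nz mem that] ab d by simp
    then have "thicken (proj R') = R'"
      by (rule thicken_proj[OF R'(1)])
    then show False
      using full' thicken_carrier R'(2) by simp
  qed
  ultimately show ?thesis
    using R unfolding maximal_subring_def by blast
qed

text \<open>Additivity and the Leibniz rule are closure of the graph under sums and products, and the Leibniz
  rule at \<open>1 \<cdot> 1\<close> forces \<open>\<delta> 1 = 0\<close>, so the unit lies in it. The image in \<open>K\<close> is everything
  because \<open>\<tau>\<close> is surjective. If \<open>\<tau> a = 0\<close>, then \<open>a = 0\<close> and so \<open>\<delta> a = 0\<close>.\<close>

lemma derivation_graph_section: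
  assumes \<tau>: "\<tau> \<in> ring_iso K K" and \<delta>: "sigma_derivation K \<tau> \<delta>"
  defines "R \<equiv> {elt (\<tau> a) (\<delta> a) | a. a \<in> carrier K}"
  shows "subring R T" and "proj R = carrier K"
    and "\<And>k. \<lbrakk>k \<in> carrier K; elt \<zero> k \<in> R\<rbrakk> \<Longrightarrow> k = \<zero>"
proof -
  have hom: "\<tau> \<in> ring_hom K K" and bij: "bij_betw \<tau> (carrier K) (carrier K)"
    using \<tau> unfolding ring_iso_def by auto
  note \<tau>_simps = ring_hom_closed[OF hom] ring_hom_add[OF hom] ring_hom_mult[OF hom]
    ring_hom_one[OF hom] ring_hom_zero[OF hom ring_axioms ring_axioms]
  have \<delta>_closed: "\<And>a. a \<in> carrier K \<Longrightarrow> \<delta> a \<in> carrier K"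
    and \<delta>_add: "\<And>a b. \<lbrakk>a \<in> carrier K; b \<in> carrier K\<rbrakk> \<Longrightarrow> \<delta> (a \<oplus> b) = \<delta> a \<oplus> \<delta> b"
    and \<delta>_mult: "\<And>a b. \<lbrakk>a \<in> carrier K; b \<in> carrier K\<rbrakk> \<Longrightarrow>
      \<delta> (a \<otimes> b) = \<tau> a \<otimes> \<delta> b \<oplus> \<tau> b \<otimes> \<delta> a"
    using \<delta> unfolding sigma_derivation_def hom_def by auto
  have el: "elt (\<tau> a) (\<delta> a) \<in> R" if "a \<in> carrier K" for a
    using that unfolding R_def by blast
  have "\<delta> \<zero> \<oplus> \<delta> \<zero> = \<delta> \<zero>"
    using \<delta>_add[of \<zero> \<zero>] by simp
  then have \<delta>_zero: "\<delta> \<zero> = \<zero>"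
    using \<delta>_closed[of \<zero>] by (simp add: add.l_cancel_one)
  have "\<delta> \<one> \<oplus> \<delta> \<one> = \<delta> \<one>"
    using \<delta>_mult[of \<one> \<one>] \<delta>_closed[of \<one>] \<tau>_simps(4) by simp
  then have \<delta>_one: "\<delta> \<one> = \<zero>"
    using \<delta>_closed[of \<one>] by (simp add: add.l_cancel_one)
  show "subring R T"
  proof (rule T.subringI)
    show "R \<subseteq> carrier T"
      unfolding R_def using \<tau>_simps(1) \<delta>_closed by auto
    show "\<one>\<^bsub>T\<^esub> \<in> R"
      using el[of \<one>] \<delta>_one \<tau>_simps(4) elt_one by simp
  next
    fix h assume "h \<in> R"
    then obtain a where a: "h = elt (\<tau> a) (\<delta> a)" "a \<in> carrier K"
      unfolding R_def by blast
    have "\<tau> (\<ominus> a) \<oplus> \<tau> a = \<zero>" "\<delta> (\<ominus> a) \<oplus> \<delta> a = \<zero>"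
      using \<tau>_simps(2)[of "\<ominus> a" a] \<delta>_add[of "\<ominus> a" a] a \<tau>_simps(5) \<delta>_zero
      by (simp_all add: l_neg)
    then have "\<ominus> \<tau> a = \<tau> (\<ominus> a)" "\<ominus> \<delta> a = \<delta> (\<ominus> a)"
      using minus_equality a \<tau>_simps(1) \<delta>_closed by auto
    then show "\<ominus>\<^bsub>T\<^esub> h \<in> R"
      using el[of "\<ominus> a"] a \<tau>_simps(1) \<delta>_closed by (simp add: elt_neg)
  next
    fix h h' assume "h \<in> R" "h' \<in> R"
    then obtain a b where ab: "h = elt (\<tau> a) (\<delta> a)" "a \<in> carrier K"
        "h' = elt (\<tau> b) (\<delta> b)" "b \<in> carrier K"
      unfolding R_def by blast
    show "h \<otimes>\<^bsub>T\<^esub> h' \<in> R"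
      using el[of "a \<otimes> b"] ab \<tau>_simps(1,3) \<delta>_closed \<delta>_mult by (simp add: elt_mult)
    show "h \<oplus>\<^bsub>T\<^esub> h' \<in> R"
      using el[of "a \<oplus> b"] ab \<tau>_simps(1,2) \<delta>_closed \<delta>_add by (simp add: elt_add)
  qed
  show "proj R = carrier K"
  proof
    show "proj R \<subseteq> carrier K"
      unfolding proj_def by blast
    show "carrier K \<subseteq> proj R"
    proof
      fix x assume x: "x \<in> carrier K"
      then obtain a where "a \<in> carrier K" "x = \<tau> a"
        using bij unfolding bij_betw_def by blast
      then show "x \<in> proj R"
        using el[of a] \<delta>_closed x unfolding proj_def by blast
    qed
  qed
  fix k assume k: "k \<in> carrier K" "elt \<zero> k \<in> R"
  then obtain a where a: "a \<in> carrier K" "elt \<zero> k = elt (\<tau> a) (\<delta> a)"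
    unfolding R_def by blast
  then have "\<tau> a = \<zero>" "k = \<delta> a"
    using elt_eq_iff k(1) \<tau>_simps(1) \<delta>_closed by (metis zero_closed)+
  moreover from this have "a = \<zero>"
    using bij a(1) \<tau>_simps(5) unfolding bij_betw_def inj_on_def by (metis zero_closed)
  ultimately show "k = \<zero>"
    using \<delta>_zero by simp
qed

text \<open>Both kinds are maximal, and every maximal subring is of one kind according to whether it contains
  \<open>K\<alpha>\<close>; the element \<open>\<alpha> = elt \<zero> \<one>\<close> makes them exclusive.\<close>

lemma maximal_subring_classification:
  defines "P \<equiv> \<lambda>R. \<exists>S. maximal_subring S K \<and> R = {elt s k | s k. s \<in> S \<and> k \<in> carrier K}"
    and "D \<equiv> \<lambda>R. \<exists>\<tau> \<delta>. \<tau> \<in> ring_iso K K \<and> sigma_derivation K \<tau> \<delta> \<and>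
      R = {elt (\<tau> a) (\<delta> a) | a. a \<in> carrier K}"
  shows "maximal_subring R T \<longleftrightarrow> P R \<and> \<not> D R \<or> \<not> P R \<and> D R"
proof -
  have P_iff: "P R \<longleftrightarrow> (\<exists>S. maximal_subring S K \<and> R = thicken S)"
    unfolding P_def thicken_def by simp
  have maxD: "maximal_subring R T" "elt \<zero> \<one> \<notin> R" if DR: "D R"
  proof -
    obtain \<tau> \<delta> where sd: "\<tau> \<in> ring_iso K K" "sigma_derivation K \<tau> \<delta>"
      and R: "R = {elt (\<tau> a) (\<delta> a) | a. a \<in> carrier K}"
      using DR unfolding D_def by blast
    note graph = derivation_graph_section[OF sd, folded R]
    show "maximal_subring R T"
      by (rule maximal_if_section[OF graph])
    show "elt \<zero> \<one> \<notin> R"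
      using graph(3)[OF one_closed] one_not_zero by blast
  qed
  have maxP: "maximal_subring R T" "elt \<zero> \<one> \<in> R" if PR: "P R"
  proof -
    obtain S where S: "maximal_subring S K" "R = thicken S"
      using PR P_iff by blast
    then show "maximal_subring R T"
      using maximal_thicken by simp
    have "\<zero> \<in> S"
      using S(1) subringE(2) unfolding maximal_subring_def by blast
    then show "elt \<zero> \<one> \<in> R"
      unfolding S(2) thicken_def by blast
  qed
  have "P R \<or> D R" if max: "maximal_subring R T"
  proof (cases "\<forall>k \<in> carrier K. elt \<zero> k \<in> R")
    case True
    have "subring R T"
      using max unfolding maximal_subring_def by blast
    then have "R = thicken (proj R)"
      using thicken_proj True by simp
    moreover have "maximal_subring (proj R) K"
      using maximal_proj[OF max] True by blast
    ultimately show ?thesis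
      using P_iff by blast
  next
    case False
    then obtain k where k: "k \<in> carrier K" "elt \<zero> k \<notin> R"
      by blast
    have R: "subring R T"
      using max unfolding maximal_subring_def by blast
    have full: "proj R = carrier K"
      using maximal_proj_full[OF max k] .
    have "b = \<zero>" if "b \<in> carrier K" "elt \<zero> b \<in> R" for b
      using contains_all_multiples[OF R full that(1) _ that(2) k(1)] k(2) by blast
    then obtain \<delta> where "sigma_derivation K id \<delta>" "R = {elt (id a) (\<delta> a) | a. a \<in> carrier K}"
      using section_is_derivation[OF R full] by auto
    moreover have "id \<in> ring_iso K K"
      unfolding ring_iso_def ring_hom_def by auto
    ultimately show ?thesis
      unfolding D_def by blast
  qed
  with maxP maxD show ?thesis
    by blast
qed

end

section \<open>The quotient by the square of the variable\<close>

context field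
begin

text \<open>Univariate polynomials are lists with the leading coefficient first and nonzero. The class
  representative \<open>a + b x\<close> is therefore the list \<open>[b, a]\<close> with leading zeros removed.\<close>

lemma linear_poly_eq:
  assumes "a \<in> carrier R" "b \<in> carrier R"
  shows "poly_of_const a \<oplus>\<^bsub>poly_ring R\<^esub> poly_of_const b \<otimes>\<^bsub>poly_ring R\<^esub> X = normalize [b, a]"
proof -
  have "poly_of_const b \<in> carrier (poly_ring R)"
    using ring_hom_closed[OF canonical_embedding_is_hom[OF carrier_is_subring], of b] assms by simp
  from poly_mult_var[OF carrier_is_subring this] show ?thesis
    using assms unfolding poly_of_const_def univ_poly_add by auto
qed

lemma var_square: "X [^]\<^bsub>poly_ring R\<^esub> (2::nat) = [\<one>, \<zero>, \<zero>]"
  using unitary_monom_eq_var_pow[OF carrier_is_subring, of 2]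
  by (simp add: monom_def numeral_2_eq_2)

text \<open>The polynomials \<open>a + b x\<close> are exactly the remainders modulo \<open>x\<^sup>2\<close>, and each class of the quotient
  contains exactly one remainder.\<close>

lemma dual_numbers_algebra:
  "dual_number_algebra R (dual_numbers R) (dual_const R) (dual_alpha R)"
proof -
  define p where "p = X [^]\<^bsub>poly_ring R\<^esub> (2::nat)"
  define h where "h = rupture_surj (carrier R) p"
  define lin where "lin = (\<lambda>a b. normalize [b, a])"
  interpret UP: domain "poly_ring R"
    using univ_poly_is_domain[OF carrier_is_subring] .
  have p: "p \<in> carrier (poly_ring R)"
    unfolding p_def by (rule var_pow_closed[OF carrier_is_subring])
  have X: "X \<in> carrier (poly_ring R)"
    by (rule var_closed(1)[OF carrier_is_subring])
  have T: "dual_numbers R = Rupt (carrier R) p"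
    unfolding dual_numbers_def p_def by simp
  interpret T: cring "dual_numbers R"
    unfolding T rupture_def
    by (rule ideal.quotient_is_cring[OF UP.cgenideal_ideal[OF p] UP.is_cring])
  have h: "h \<in> ring_hom (poly_ring R) (dual_numbers R)"
    unfolding T h_def by (rule rupture_surj_hom(1)[OF carrier_is_subring p])
  have const_hom: "poly_of_const \<in> ring_hom R (poly_ring R)"
    using canonical_embedding_is_hom[OF carrier_is_subring] by simp
  have const: "dual_const R = h \<circ> poly_of_const" and alpha: "dual_alpha R = h X"
    unfolding dual_const_def dual_alpha_def dual_class_def h_def p_def by auto
  have lin_closed: "lin a b \<in> carrier (poly_ring R)"
    if "a \<in> carrier R" "b \<in> carrier R" for a b
    using linear_poly_eq[OF that] ring_hom_closed[OF const_hom] that X unfolding lin_def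
    by (metis UP.add.m_closed UP.m_closed)
  have elt: "dual_const R a \<oplus>\<^bsub>dual_numbers R\<^esub> dual_const R b \<otimes>\<^bsub>dual_numbers R\<^esub> dual_alpha R
      = h (lin a b)" if "a \<in> carrier R" "b \<in> carrier R" for a b
    unfolding const alpha lin_def linear_poly_eq[OF that, symmetric]
    using that X ring_hom_closed[OF const_hom] ring_hom_add[OF h] ring_hom_mult[OF h] by simp
  have lin_pmod: "lin a b pmod p = lin a b" if "a \<in> carrier R" "b \<in> carrier R" for a b
  proof (rule pmod_const(2)[OF carrier_is_subfield lin_closed[OF that] p])
    show "degree (lin a b) < degree p"
      unfolding lin_def p_def var_square by simp
  qed
  show ?thesis
  proof (unfold_locales)
    show "dual_const R \<in> ring_hom R (dual_numbers R)"
      unfolding const by (rule ring_hom_trans[OF const_hom h])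
    show "dual_alpha R \<in> carrier (dual_numbers R)"
      unfolding alpha using ring_hom_closed[OF h X] .
    have "dual_alpha R \<otimes>\<^bsub>dual_numbers R\<^esub> dual_alpha R = h p"
      unfolding alpha p_def using ring_hom_mult[OF h X X] X by (simp add: numeral_2_eq_2)
    also have "h p = \<zero>\<^bsub>dual_numbers R\<^esub>"
      unfolding h_def T rupture_def FactRing_def
      using p by (simp add: UP.a_rcos_zero UP.cgenideal_ideal UP.cgenideal_self)
    finally show "dual_alpha R \<otimes>\<^bsub>dual_numbers R\<^esub> dual_alpha R = \<zero>\<^bsub>dual_numbers R\<^esub>" .
  next
    fix t assume "t \<in> carrier (dual_numbers R)"
    then obtain q where q: "q \<in> carrier (poly_ring R)" "t = h (q pmod p)"
      unfolding T h_def using rupture_carrier_as_pmod_image[OF carrier_is_subfield p] by blast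
    let ?r = "q pmod p"
    have r: "?r \<in> carrier (poly_ring R)"
      using long_division_closed(2)[OF carrier_is_subfield q(1) p] .
    have "?r = [] \<or> degree ?r < degree p"
      using pmod_degree[OF carrier_is_subfield q(1) p] unfolding p_def var_square by simp
    then have "length ?r \<le> 2"
      unfolding p_def var_square by auto
    then consider "?r = []" | a where "?r = [a]" | b a where "?r = [b, a]"
      by (cases ?r; cases "tl ?r"; cases "tl (tl ?r)") auto
    then have "\<exists>a \<in> carrier R. \<exists>b \<in> carrier R. ?r = lin a b"
    proof cases
      case 1
      then show ?thesis
        by (auto simp: lin_def intro!: bexI[of _ \<zero>])
    next
      case (2 a)
      then show ?thesis
        using r unfolding sym[OF univ_poly_carrier] polynomial_def
        by (auto simp: lin_def intro!: bexI[of _ \<zero>] bexI[of _ a])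
    next
      case (3 b a)
      then have "?r = lin a b" "a \<in> carrier R" "b \<in> carrier R"
        using r unfolding sym[OF univ_poly_carrier] polynomial_def by (auto simp: lin_def)
      then show ?thesis
        by blast
    qed
    then show "\<exists>a \<in> carrier R. \<exists>b \<in> carrier R. t = dual_const R a \<oplus>\<^bsub>dual_numbers R\<^esub>
        dual_const R b \<otimes>\<^bsub>dual_numbers R\<^esub> dual_alpha R"
      using elt q(2) by metis
  next
    fix a b a' b'
    assume cl: "a \<in> carrier R" "b \<in> carrier R" "a' \<in> carrier R" "b' \<in> carrier R"
      and "dual_const R a \<oplus>\<^bsub>dual_numbers R\<^esub> dual_const R b \<otimes>\<^bsub>dual_numbers R\<^esub> dual_alpha R =
        dual_const R a' \<oplus>\<^bsub>dual_numbers R\<^esub> dual_const R b' \<otimes>\<^bsub>dual_numbers R\<^esub> dual_alpha R"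
    then have "h (lin a b) = h (lin a' b')"
      using elt by simp
    moreover have "lin a b \<in> (\<lambda>q. q pmod p) ` carrier (poly_ring R)"
        "lin a' b' \<in> (\<lambda>q. q pmod p) ` carrier (poly_ring R)"
      using lin_pmod lin_closed cl by (metis imageI)+
    ultimately have "lin a b = lin a' b'"
      using rupture_surj_inj_on[OF carrier_is_subfield p] unfolding h_def inj_on_def by blast
    then show "a = a' \<and> b = b'"
      unfolding lin_def by (auto split: if_splits)
  qed
qed

end

theorem theorem3p11:
  fixes K :: "('a, 'b) ring_scheme" and R :: "'a list set set"
  assumes "field K"
  shows "maximal_subring R (dual_numbers K) \<longleftrightarrow>
    (is_preimage_subring K R \<and> \<not> is_derivation_subring K R) \<or>
    (\<not> is_preimage_subring K R \<and> is_derivation_subring K R)"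
proof -
  interpret dual_number_algebra K "dual_numbers K" "dual_const K" "dual_alpha K"
    using field.dual_numbers_algebra[OF assms] .
  show ?thesis
    using maximal_subring_classification[of R]
    unfolding is_preimage_subring_def is_derivation_subring_def elt_def .
qed

end
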